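(* There is $w\in\beta\mathbb Z\setminus\{0\}$ such that the relation $\equiv_w$ on $\beta\mathbb Z$ is not symmetric.
   Context: $\beta\mathbb Z$ is the space of ultrafilters on $\mathbb Z$; integers are identified with principal ultrafilters. For $u,v\in\beta\mathbb Z$: $A\in u\otimes v$ iff $\{x:\{y:(x,y)\in A\}\in v\}\in u$ (for $A\subseteq\mathbb Z^2$); $A\in u\oplus v$ iff $\{x:\{y:x+y\in A\}\in v\}\in u$; $-u=\{-A:A\in u\}$; $u\ominus v=u\oplus(-v)$. Fix an elementary extension ${}^{*}\mathbb Z$ of $\mathbb Z$, in the language with a symbol for every subset of every $\mathbb Z^k$, that is $(2^{\aleph_0})^+$-saturated. For a tuple $a$ in ${}^{*}\mathbb Z$ and an ultrafilter $u$ on $\mathbb Z^k$, $a\models u$ means $u=\{A\subseteq\mathbb Z^k:a\in{}^{*}A\}$. For $w\in\beta\mathbb Z\setminus\{0\}$: $u\equiv_w v$ iff there are $d\models w$ and $(a,b)\models u\otimes v$ with $d\mid a-b$; equivalently, every set in $w$ that is upward closed under divisibility belongs to $u\ominus v$. *)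

theory Defs
  imports Main
begin

unbundle cardinal_syntax

text \<open>
  An ultrafilter is a value of the library type of filters, and \<open>A \<in> u\<close> is
  rendered as \<^term>\<open>\<forall>\<^sub>F x in u. x \<in> A\<close>.
\<close>

definition ultrafilter :: "'a filter \<Rightarrow> bool" where
  "ultrafilter u \<longleftrightarrow> u \<noteq> bot \<and> (\<forall>P. (\<forall>\<^sub>F x in u. P x) \<or> (\<forall>\<^sub>F x in u. \<not> P x))"

definition betaZ :: "int filter set" where
  "betaZ = {u. ultrafilter u}"

definition tensor :: "'a filter \<Rightarrow> 'b filter \<Rightarrow> ('a \<times> 'b) filter"  (infixr \<open>\<otimes>\<^sub>u\<close> 75) where
  "u \<otimes>\<^sub>u v = Abs_filter (\<lambda>P. \<forall>\<^sub>F x in u. \<forall>\<^sub>F y in v. P (x, y))"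

lemma eventually_tensor:
  "(\<forall>\<^sub>F z in u \<otimes>\<^sub>u v. P z) \<longleftrightarrow> (\<forall>\<^sub>F x in u. \<forall>\<^sub>F y in v. P (x, y))"
  unfolding tensor_def
proof (rule eventually_Abs_filter, rule is_filter.intro)
  show "\<forall>\<^sub>F x in u. \<forall>\<^sub>F y in v. True" by simp
next
  fix P Q :: "'a \<times> 'b \<Rightarrow> bool"
  assume "\<forall>\<^sub>F x in u. \<forall>\<^sub>F y in v. P (x, y)" "\<forall>\<^sub>F x in u. \<forall>\<^sub>F y in v. Q (x, y)"
  then show "\<forall>\<^sub>F x in u. \<forall>\<^sub>F y in v. P (x, y) \<and> Q (x, y)"
    by eventually_elim (rule eventually_conj)
next
  fix P Q :: "'a \<times> 'b \<Rightarrow> bool"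
  assume "\<forall>z. P z \<longrightarrow> Q z" and P: "\<forall>\<^sub>F x in u. \<forall>\<^sub>F y in v. P (x, y)"
  from P show "\<forall>\<^sub>F x in u. \<forall>\<^sub>F y in v. Q (x, y)"
    by eventually_elim (erule eventually_mono, use \<open>\<forall>z. P z \<longrightarrow> Q z\<close> in blast)
qed

text \<open>
  First-order formulas in the language with one relation symbol for every subset of every
  \<open>\<int>\<^sup>k\<close>, and with constants for parameters from \<open>'c\<close>. Elements of \<open>\<int>\<^sup>k\<close> are lists of
  length \<open>k\<close>; the arity of a symbol is enforced by \<open>wf_fm\<close>.
\<close>

datatype (params_tm: 'c) tm = Var nat | Par 'c

datatype (params: 'c) fm =
    FRel "int list set" "'c tm list"
  | FEq "'c tm" "'c tm"
  | FNeg "'c fm"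
  | FConj "'c fm" "'c fm"
  | FEx nat "'c fm"

fun fv_tm :: "'c tm \<Rightarrow> nat set" where
  "fv_tm (Var x) = {x}"
| "fv_tm (Par c) = {}"

primrec fv :: "'c fm \<Rightarrow> nat set" where
  "fv (FRel A ts) = (\<Union>t\<in>set ts. fv_tm t)"
| "fv (FEq s t) = fv_tm s \<union> fv_tm t"
| "fv (FNeg p) = fv p"
| "fv (FConj p q) = fv p \<union> fv q"
| "fv (FEx x p) = fv p - {x}"

primrec wf_fm :: "'c fm \<Rightarrow> bool" where
  "wf_fm (FRel A ts) \<longleftrightarrow> A \<subseteq> {xs. length xs = length ts}"
| "wf_fm (FEq s t) \<longleftrightarrow> True"
| "wf_fm (FNeg p) \<longleftrightarrow> wf_fm p"
| "wf_fm (FConj p q) \<longleftrightarrow> wf_fm p \<and> wf_fm q"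
| "wf_fm (FEx x p) \<longleftrightarrow> wf_fm p"

fun val :: "(nat \<Rightarrow> 'm) \<Rightarrow> 'm tm \<Rightarrow> 'm" where
  "val env (Var x) = env x"
| "val env (Par c) = c"

text \<open>
  Satisfaction in the structure with universe \<open>'m\<close> that interprets the symbol of \<open>A\<close> by
  \<open>I A\<close>. The structure \<open>\<int>\<close> itself is given by the interpretation \<open>\<lambda>A. A\<close>.
\<close>

primrec sat :: "(int list set \<Rightarrow> 'm list set) \<Rightarrow> (nat \<Rightarrow> 'm) \<Rightarrow> 'm fm \<Rightarrow> bool" where
  "sat I env (FRel A ts) \<longleftrightarrow> map (val env) ts \<in> I A"
| "sat I env (FEq s t) \<longleftrightarrow> val env s = val env t"
| "sat I env (FNeg p) \<longleftrightarrow> \<not> sat I env p"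
| "sat I env (FConj p q) \<longleftrightarrow> sat I env p \<and> sat I env q"
| "sat I env (FEx x p) \<longleftrightarrow> (\<exists>a. sat I (env(x := a)) p)"

text \<open>\<open>\<int>\<close> is identified with its image under \<open>emb\<close>.\<close>

definition elementary_extension ::
  "(int \<Rightarrow> 'm) \<Rightarrow> (int list set \<Rightarrow> 'm list set) \<Rightarrow> bool" where
  "elementary_extension emb I \<longleftrightarrow>
     (\<forall>p env. wf_fm p \<longrightarrow> (sat (\<lambda>A. A) env p \<longleftrightarrow> sat I (emb \<circ> env) (map_fm emb p)))"

text \<open>
  \<open>\<kappa>\<close>-saturation, for a cardinal \<open>\<kappa>\<close>: every finitely satisfiable set of formulas in
  finitely many variables, over a set of fewer than \<open>\<kappa>\<close> parameters, is realized.
\<close>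

definition saturated :: "'k rel \<Rightarrow> (int list set \<Rightarrow> 'm list set) \<Rightarrow> bool" where
  "saturated \<kappa> I \<longleftrightarrow>
     (\<forall>n C S. |C| <o \<kappa> \<longrightarrow>
        (\<forall>p\<in>S. wf_fm p \<and> fv p \<subseteq> {..<n} \<and> params p \<subseteq> C) \<longrightarrow>
        (\<forall>F. finite F \<and> F \<subseteq> S \<longrightarrow> (\<exists>env. \<forall>p\<in>F. sat I env p)) \<longrightarrow>
        (\<exists>env. \<forall>p\<in>S. sat I env p))"

text \<open>\<open>a \<Turnstile> u\<close>, for a single element and for a pair.\<close>

definition realizes :: "(int list set \<Rightarrow> 'm list set) \<Rightarrow> 'm \<Rightarrow> int filter \<Rightarrow> bool" where
  "realizes I a u \<longleftrightarrow> (\<forall>A. (\<forall>\<^sub>F x in u. x \<in> A) \<longleftrightarrow> [a] \<in> I {[x] |x. x \<in> A})"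

definition realizes2 ::
  "(int list set \<Rightarrow> 'm list set) \<Rightarrow> 'm \<times> 'm \<Rightarrow> (int \<times> int) filter \<Rightarrow> bool" where
  "realizes2 I ab u \<longleftrightarrow>
     (\<forall>A. (\<forall>\<^sub>F z in u. z \<in> A) \<longleftrightarrow> [fst ab, snd ab] \<in> I {[x, y] |x y. (x, y) \<in> A})"

text \<open>
  \<open>d \<bar> a - b\<close> in the extension, where subtraction is the function whose graph interprets
  the symbol of the graph of subtraction on \<open>\<int>\<close>; \<open>c\<close> is the difference.
\<close>

definition dvd_diff :: "(int list set \<Rightarrow> 'm list set) \<Rightarrow> 'm \<Rightarrow> 'm \<Rightarrow> 'm \<Rightarrow> bool" where
  "dvd_diff I d a b \<longleftrightarrow>
     (\<exists>c. [a, b, c] \<in> I {[x, y, x - y] |x y. True} \<and> [d, c] \<in> I {[x, y] |x y. x dvd y})"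

definition equiv_mod ::
  "(int list set \<Rightarrow> 'm list set) \<Rightarrow> int filter \<Rightarrow> int filter \<Rightarrow> int filter \<Rightarrow> bool" where
  "equiv_mod I w u v \<longleftrightarrow>
     (\<exists>d a b. realizes I d w \<and> realizes2 I (a, b) (u \<otimes>\<^sub>u v) \<and> dvd_diff I d a b)"

end

theory Submission
  imports Defs
begin

text \<open>
  If \<open>(a, b) \<Turnstile> u \<otimes> v\<close> and \<open>w\<close> is the type of \<open>a - b\<close>, then \<open>u \<equiv>\<^sub>w v\<close> holds trivially. So it is
  enough to find a divisibility-closed set that belongs to \<open>u \<ominus> v\<close> but not to \<open>v \<ominus> u\<close>. Let
  \<open>s\<close> be a sequence such that \<open>s\<^sub>n\<close> is divisible by every positive integer up to
  \<open>s\<^sub>m + 3\<close> for \<open>m < n\<close>, let \<open>u\<close> be nonprincipal and concentrated on the range of \<open>s\<close>, and let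
  \<open>v = u + 1\<close>. Then \<open>u \<ominus> v\<close> lives on the numbers \<open>s\<^sub>k - (s\<^sub>l + 1)\<close> with \<open>k < l\<close>, and \<open>v \<ominus> u\<close>
  on the numbers \<open>(s\<^sub>m + 1) - s\<^sub>n\<close> with \<open>m < n\<close>, none of which is a multiple of one of the former.
  Saturation supplies \<open>u\<close> as the type of an element of the extension.
\<close>

section \<open>Transfer\<close>

lemma val_cong: "(\<And>x. x \<in> fv_tm t \<Longrightarrow> e x = e' x) \<Longrightarrow> val e t = val e' t"
  by (cases t) auto

lemma sat_cong: "(\<And>x. x \<in> fv p \<Longrightarrow> e x = e' x) \<Longrightarrow> sat J e p \<longleftrightarrow> sat J e' p"
proof (induction p arbitrary: e e')
  case (FRel A ts)
  then have "map (val e) ts = map (val e') ts"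
    by (auto intro!: val_cong)
  then show ?case by (simp only: sat.simps)
next
  case (FEq s t)
  then have "val e s = val e' s" "val e t = val e' t"
    by (auto intro!: val_cong)
  then show ?case by simp
next
  case (FNeg p)
  from FNeg.IH[of e e'] FNeg.prems show ?case by simp
next
  case (FConj p q)
  from FConj.IH[of e e'] FConj.prems show ?case by simp
next
  case (FEx x p)
  have "sat J (e(x := a)) p \<longleftrightarrow> sat J (e'(x := a)) p" for a
    using FEx.prems by (intro FEx.IH) auto
  then show ?case by simp
qed

lemma fv_tm_map [simp]: "fv_tm (map_tm f t) = fv_tm t"
  by (cases t) auto

lemma fv_map [simp]: "fv (map_fm f p) = fv p"
  by (induction p) auto

lemma finite_fv: "finite (fv p)"
proof (induction p)
  case (FRel A ts)
  have "finite (fv_tm t)" for t :: "'a tm" by (cases t) auto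
  then show ?case by simp
next
  case (FEq s t)
  have "finite (fv_tm t)" for t :: "'a tm" by (cases t) auto
  then show ?case by simp
qed auto

text \<open>Universal quantification over the variables below \<open>n\<close>, spelled with
  \<open>FNeg\<close> and \<open>FEx\<close> because \<open>fm\<close> has no universal
  quantifier.\<close>

primrec closure_fm :: "nat \<Rightarrow> 'c fm \<Rightarrow> 'c fm" where
  "closure_fm 0 p = p"
| "closure_fm (Suc n) p = closure_fm n (FNeg (FEx n (FNeg p)))"

lemma wf_closure_fm [simp]: "wf_fm (closure_fm n p) \<longleftrightarrow> wf_fm p"
  by (induction n arbitrary: p) auto

lemma map_closure_fm [simp]: "map_fm f (closure_fm n p) = closure_fm n (map_fm f p)"
  by (induction n arbitrary: p) auto

lemma sat_closure_fm:
  "sat J e (closure_fm n p) \<longleftrightarrow> (\<forall>e'. sat J (\<lambda>i. if i < n then e' i else e i) p)"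
proof (induction n arbitrary: p)
  case (Suc n)
  have upd: "(\<lambda>i. if i < n then e' i else e i)(n := a)
      = (\<lambda>i. if i < Suc n then (e'(n := a)) i else e i)" for e' a
    by (auto simp: fun_eq_iff less_Suc_eq)
  show ?case
    unfolding closure_fm.simps Suc.IH sat.simps not_ex not_not upd
    by (metis fun_upd_triv)
qed simp

text \<open>Elementarity only compares environments with values in the range of \<open>emb\<close>.
  Binding all free variables of \<open>p\<close> first gives a sentence, whose truth in the
  extension then speaks about every environment there.\<close>

lemma transfer:
  assumes "elementary_extension emb I" "wf_fm p" "\<And>env. sat (\<lambda>A. A) env p"
  shows "sat I env (map_fm emb p)"
proof -
  obtain n where n: "fv p \<subseteq> {..<n}"
    using finite_fv[of p] finite_nat_set_iff_bounded[of "fv p"] by auto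
  \<comment> \<open>Any integer environment would do: the closure overwrites all indices below
    \<open>n\<close>, among them the free variables of \<open>p\<close>.\<close>
  have "sat I (emb \<circ> (\<lambda>_. 0)) (map_fm emb (closure_fm n p))"
    using assms unfolding elementary_extension_def
    by (metis sat_closure_fm wf_closure_fm)
  then have "sat I (\<lambda>i. if i < n then env i else (emb \<circ> (\<lambda>_. 0)) i) (map_fm emb p)"
    unfolding map_closure_fm sat_closure_fm by blast
  moreover have "sat I (\<lambda>i. if i < n then env i else (emb \<circ> (\<lambda>_. 0)) i) (map_fm emb p)
      \<longleftrightarrow> sat I env (map_fm emb p)"
    using n by (intro sat_cong) auto
  ultimately show ?thesis by simp
qed

text \<open>Saturation is applied without parameters, to the symbols in \<open>S\<close> on the
  variables below \<open>n\<close>. Finite satisfiability comes from integer points, moved into the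
  extension by \<open>emb\<close>.\<close>

lemma saturated_realizes:
  assumes ext: "elementary_extension emb I" and sat: "saturated (cardSuc |UNIV :: nat set set| ) I"
    and len: "\<And>A. A \<in> S \<Longrightarrow> A \<subseteq> {xs. length xs = n}"
    and fip: "\<And>F. finite F \<Longrightarrow> F \<subseteq> S \<Longrightarrow> \<exists>xs. length xs = n \<and> xs \<in> \<Inter>F"
  shows "\<exists>as. length as = n \<and> (\<forall>A\<in>S. as \<in> I A)"
proof -
  let ?p = "\<lambda>A. FRel A (map Var [0..<n])"
  have "|{} :: 'b set| <o cardSuc |UNIV :: nat set set|"
    using cardSuc_greater[OF card_of_Card_order] card_of_empty ordLeq_ordLess_trans by blast
  moreover have "\<forall>p \<in> ?p ` S. wf_fm p \<and> fv p \<subseteq> {..<n} \<and> params p \<subseteq> ({} :: 'b set)"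
    using len by fastforce
  moreover have "\<exists>env. \<forall>p\<in>F. sat I env p" if F: "finite F \<and> F \<subseteq> ?p ` S" for F
  proof -
    obtain F0 where F0: "finite F0" "F0 \<subseteq> S" "F = ?p ` F0"
      using F finite_subset_image by metis
    obtain xs where xs: "length xs = n" "xs \<in> \<Inter>F0"
      using fip F0 by blast
    let ?e = "\<lambda>i. xs ! i"
    have "sat I (emb \<circ> ?e) (?p A)" if "A \<in> F0" for A
    proof -
      have "map ((!) xs) [0..<n] = xs" using xs(1) map_nth by blast
      then have "sat (\<lambda>A. A) ?e (?p A)"
        using that xs(2) by (simp add: comp_def)
      moreover have "wf_fm (?p A)" using that F0(2) len by fastforce
      ultimately have "sat I (emb \<circ> ?e) (map_fm emb (?p A))"
        using ext unfolding elementary_extension_def by blast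
      then show ?thesis by (simp add: comp_def)
    qed
    then show ?thesis unfolding F0(3) by blast
  qed
  ultimately have "\<exists>env. \<forall>p \<in> ?p ` S. sat I env p"
    using sat[unfolded saturated_def, rule_format, of "{}" "?p ` S" n] by blast
  then obtain env where "\<forall>p \<in> ?p ` S. sat I env p" ..
  then have "\<forall>A\<in>S. map env [0..<n] \<in> I A"
    by (simp add: comp_def)
  then show ?thesis by (intro exI[of _ "map env [0..<n]"]) simp
qed

section \<open>Sets and divisibility in the extension\<close>

context
  fixes emb :: "int \<Rightarrow> 'm" and I :: "int list set \<Rightarrow> 'm list set"
  assumes ext: "elementary_extension emb I"
begin

lemma star1_UNIV: "[a] \<in> I {[x] |x. True}"
  using transfer[OF ext, of "FRel {[x] |x. True} [Var 0]" "\<lambda>_. a"] by (auto simp: Collect_mono_iff imp_ex)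

text \<open>Here and below an implication is written \<open>FNeg (FConj P (FNeg Q))\<close>; it is
  valid over the integers and therefore transfers.\<close>

lemma star1_mono:
  assumes "[a] \<in> I {[x] |x. x \<in> A}" "A \<subseteq> B"
  shows "[a] \<in> I {[x] |x. x \<in> B}"
  using transfer[OF ext, of "FNeg (FConj (FRel {[x] |x. x \<in> A} [Var 0])
      (FNeg (FRel {[x] |x. x \<in> B} [Var 0])))" "\<lambda>_. a"] assms by (auto simp: Collect_mono_iff imp_ex)

lemma star1_Int:
  assumes "[a] \<in> I {[x] |x. x \<in> A}" "[a] \<in> I {[x] |x. x \<in> B}"
  shows "[a] \<in> I {[x] |x. x \<in> A \<inter> B}"
  using transfer[OF ext, of "FNeg (FConj (FConj (FRel {[x] |x. x \<in> A} [Var 0])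
      (FRel {[x] |x. x \<in> B} [Var 0])) (FNeg (FRel {[x] |x. x \<in> A \<inter> B} [Var 0])))" "\<lambda>_. a"]
    assms by (auto simp: Collect_mono_iff imp_ex)

lemma star1_Compl: "[a] \<in> I {[x] |x. x \<in> - A} \<longleftrightarrow> [a] \<notin> I {[x] |x. x \<in> A}"
  using transfer[OF ext, of "FNeg (FConj (FRel {[x] |x. x \<in> A} [Var 0])
      (FRel {[x] |x. x \<in> - A} [Var 0]))" "\<lambda>_. a"]
    transfer[OF ext, of "FNeg (FConj (FNeg (FRel {[x] |x. x \<in> A} [Var 0]))
      (FNeg (FRel {[x] |x. x \<in> - A} [Var 0])))" "\<lambda>_. a"] by (auto simp: Collect_mono_iff imp_ex)

lemma star2_Compl:
  "[a, b] \<in> I {[x, y] |x y. (x, y) \<in> - A} \<longleftrightarrow> [a, b] \<notin> I {[x, y] |x y. (x, y) \<in> A}"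
  using transfer[OF ext, of "FNeg (FConj (FRel {[x, y] |x y. (x, y) \<in> A} [Var 0, Var 1])
      (FRel {[x, y] |x y. (x, y) \<in> - A} [Var 0, Var 1]))" "\<lambda>i. if i = 0 then a else b"]
    transfer[OF ext, of "FNeg (FConj (FNeg (FRel {[x, y] |x y. (x, y) \<in> A} [Var 0, Var 1]))
      (FNeg (FRel {[x, y] |x y. (x, y) \<in> - A} [Var 0, Var 1])))" "\<lambda>i. if i = 0 then a else b"]
  by (auto simp: Collect_mono_iff imp_ex)

lemma star_diff_total: "\<exists>c. [a, b, c] \<in> I {[x, y, x - y] |x y. True}"
  using transfer[OF ext, of "FEx 2 (FRel {[x, y, x - y] |x y. True} [Var 0, Var 1, Var 2])"
      "\<lambda>i. if i = 0 then a else b"] by (auto simp: Collect_mono_iff imp_ex)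

lemma star_diff:
  assumes "[a, b, c] \<in> I {[x, y, x - y] |x y. True}"
    and "[a, b] \<in> I {[x, y] |x y. (x, y) \<in> {(x, y). x - y \<in> A}}"
  shows "[c] \<in> I {[x] |x. x \<in> A}"
  using transfer[OF ext, of "FNeg (FConj (FConj (FRel {[x, y, x - y] |x y. True} [Var 0, Var 1, Var 2])
      (FRel {[x, y] |x y. (x, y) \<in> {(x, y). x - y \<in> A}} [Var 0, Var 1]))
      (FNeg (FRel {[x] |x. x \<in> A} [Var 2])))"
      "\<lambda>i. if i = 0 then a else if i = 1 then b else c"] assms by (auto simp: Collect_mono_iff imp_ex)

lemma star_dvd_refl: "[d, d] \<in> I {[x, y] |x y. x dvd y}"
  using transfer[OF ext, of "FRel {[x, y] |x y. x dvd y} [Var 0, Var 0]" "\<lambda>_. d"] by (auto simp: Collect_mono_iff imp_ex)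

text \<open>With \<open>diff_multiples\<close> for \<open>B\<close>, this carries membership from a
  realization of \<open>w\<close> to a difference that it divides.\<close>

lemma star_dvd_closed:
  assumes "[d] \<in> I {[x] |x. x \<in> B}" "[d, c] \<in> I {[x, y] |x y. x dvd y}"
    and "\<And>x y. x \<in> B \<Longrightarrow> x dvd y \<Longrightarrow> y \<in> B"
  shows "[c] \<in> I {[x] |x. x \<in> B}"
  using transfer[OF ext, of "FNeg (FConj (FConj (FRel {[x] |x. x \<in> B} [Var 0])
      (FRel {[x, y] |x y. x dvd y} [Var 0, Var 1]))
      (FNeg (FRel {[x] |x. x \<in> B} [Var 1])))"
      "\<lambda>i. if i = 0 then d else c"] assms by (auto simp: Collect_mono_iff imp_ex)

section \<open>Types as ultrafilters\<close>

definition type_of :: "'m \<Rightarrow> int filter" where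
  "type_of a = Abs_filter (\<lambda>P. [a] \<in> I {[x] |x. P x})"

lemma eventually_type_of: "(\<forall>\<^sub>F x in type_of a. P x) \<longleftrightarrow> [a] \<in> I {[x] |x. P x}"
  unfolding type_of_def
proof (rule eventually_Abs_filter, rule is_filter.intro)
  show "[a] \<in> I {[x] |x. True}" by (rule star1_UNIV)
next
  fix P Q assume "[a] \<in> I {[x] |x. P x}" "[a] \<in> I {[x] |x. Q x}"
  then show "[a] \<in> I {[x] |x. P x \<and> Q x}"
    using star1_Int[of a "Collect P" "Collect Q"] by simp
next
  fix P Q :: "int \<Rightarrow> bool" assume "\<forall>x. P x \<longrightarrow> Q x" "[a] \<in> I {[x] |x. P x}"
  then show "[a] \<in> I {[x] |x. Q x}"
    using star1_mono[of a "Collect P" "Collect Q"] by auto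
qed

lemma realizes_type_of: "realizes I a (type_of a)"
  by (simp add: realizes_def eventually_type_of)

lemma ultrafilter_type_of: "ultrafilter (type_of a)"
proof -
  have "(\<forall>\<^sub>F x in type_of a. \<not> P x) \<longleftrightarrow> \<not> (\<forall>\<^sub>F x in type_of a. P x)" for P
    using star1_Compl[of a "Collect P"] by (simp add: eventually_type_of)
  \<comment> \<open>The instance at \<open>True\<close> says that \<open>False\<close> is not
    eventually true, so the filter is proper.\<close>
  from this this[of "\<lambda>_. True"] show ?thesis
    unfolding ultrafilter_def by (auto simp: trivial_limit_def)
qed

end

lemma ultrafilter_not_eventually:
  assumes "ultrafilter u"
  shows "(\<forall>\<^sub>F x in u. \<not> P x) \<longleftrightarrow> \<not> (\<forall>\<^sub>F x in u. P x)"
proof -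
  have "\<not> ((\<forall>\<^sub>F x in u. \<not> P x) \<and> (\<forall>\<^sub>F x in u. P x))"
    using assms by (simp add: ultrafilter_def eventually_conj_iff[symmetric])
  then show ?thesis
    using assms unfolding ultrafilter_def by blast
qed

text \<open>For an ultrafilter, negation commutes with \<open>eventually\<close>, so it moves
  through both layers of the tensor product.\<close>

lemma ultrafilter_tensor:
  assumes "ultrafilter u" "ultrafilter v"
  shows "ultrafilter (u \<otimes>\<^sub>u v)"
proof -
  have "u \<noteq> bot" "v \<noteq> bot"
    using assms by (simp_all add: ultrafilter_def)
  then have "u \<otimes>\<^sub>u v \<noteq> bot"
    by (simp add: trivial_limit_def eventually_tensor)
  then show ?thesis
    unfolding ultrafilter_def[of "u \<otimes>\<^sub>u v"]
    by (simp add: eventually_tensor assms[THEN ultrafilter_not_eventually])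
qed

lemma ultrafilter_filtermap: "ultrafilter u \<Longrightarrow> ultrafilter (filtermap f u)"
  by (auto simp: ultrafilter_def filtermap_bot_iff eventually_filtermap)

text \<open>Finitely many members of \<open>u\<close> have a common point, so saturation yields a
  pair in the extension of every member. Conversely, a set outside \<open>u\<close> has its
  complement in \<open>u\<close>, which excludes the pair from that set.\<close>

lemma realizes2_exists:
  assumes ext: "elementary_extension emb I" and sat: "saturated (cardSuc |UNIV :: nat set set| ) I"
    and u: "ultrafilter u"
  shows "\<exists>ab. realizes2 I ab u"
proof -
  let ?S = "(\<lambda>A. {[x, y] |x y. (x, y) \<in> A}) ` {A. \<forall>\<^sub>F z in u. z \<in> A}"
  have "\<exists>as. length as = 2 \<and> (\<forall>A\<in>?S. as \<in> I A)"
  proof (rule saturated_realizes[OF ext sat])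
    fix F assume F: "finite F" "F \<subseteq> ?S"
    obtain F0 where F0: "finite F0" "F0 \<subseteq> {A. \<forall>\<^sub>F z in u. z \<in> A}"
        "F = (\<lambda>A. {[x, y] |x y. (x, y) \<in> A}) ` F0"
      using finite_subset_image[OF F] by (elim exE conjE)
    then have "\<forall>\<^sub>F z in u. \<forall>A\<in>F0. z \<in> A"
      by (subst eventually_ball_finite_distrib) auto
    moreover have "u \<noteq> bot" using u by (simp add: ultrafilter_def)
    ultimately obtain z where "\<forall>A\<in>F0. z \<in> A"
      using eventually_happens' by blast
    then show "\<exists>xs. length xs = 2 \<and> xs \<in> \<Inter>F"
      by (intro exI[of _ "[fst z, snd z]"]) (auto simp: F0(3))
  qed auto
  then obtain a b where ab: "\<And>A. (\<forall>\<^sub>F z in u. z \<in> A) \<Longrightarrow> [a, b] \<in> I {[x, y] |x y. (x, y) \<in> A}"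
    by (auto simp: length_Suc_conv numeral_2_eq_2)
  have "(\<forall>\<^sub>F z in u. z \<in> A) \<longleftrightarrow> [a, b] \<in> I {[x, y] |x y. (x, y) \<in> A}" for A
    using ab[of A] ab[of "- A"] star2_Compl[OF ext, of a b A] ultrafilter_not_eventually[OF u, of "\<lambda>z. z \<in> A"]
    by auto
  then have "realizes2 I (a, b) u" by (simp add: realizes2_def)
  then show ?thesis ..
qed

section \<open>A fast growing sequence\<close>

text \<open>The factorial provides divisibility by all small numbers. The offset 3 makes each term
  more than twice the preceding one, already from \<open>fseq 0 = 1\<close>.\<close>

primrec fseq :: "nat \<Rightarrow> nat" where
  "fseq 0 = 1"
| "fseq (Suc n) = fact (fseq n + 3)"

lemma fseq_pos: "fseq n \<ge> 1"
  by (cases n) (simp_all add: fact_ge_1 del: fact_Suc)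

lemma fseq_Suc: "fseq (Suc n) > 2 * fseq n + 3"
proof -
  let ?x = "fseq n"
  have "fact (?x + 3) = (?x + 3) * ((?x + 2) * fact (?x + 1) :: nat)"
    by (simp add: numeral_3_eq_3)
  moreover have "(?x + 2) * fact (?x + 1) \<ge> (3 :: nat)"
    using fseq_pos[of n] fact_ge_1[of "?x + 1", where 'a = nat]
      mult_le_mono[of 3 "?x + 2" 1 "fact (?x + 1)"]
    by linarith
  ultimately have "fact (?x + 3) \<ge> (?x + 3) * (3 :: nat)"
    using mult_le_mono2 by presburger
  then show ?thesis by simp
qed

lemma fseq_mono: "m \<le> n \<Longrightarrow> fseq m \<le> fseq n"
proof (rule lift_Suc_mono_le[of fseq])
  show "fseq i \<le> fseq (Suc i)" for i using fseq_Suc[of i] by linarith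
qed

lemma fseq_gap: "m < n \<Longrightarrow> fseq n > 2 * fseq m + 3"
  using fseq_Suc[of m] fseq_mono[of "Suc m" n] by simp

text \<open>The predecessor \<open>j\<close> of \<open>n\<close> satisfies \<open>l \<le> j\<close>,
  so \<open>d\<close> is among the factors of the factorial defining \<open>fseq n\<close>.\<close>

lemma dvd_fseq:
  assumes "l < n" "0 < d" "d \<le> fseq l + 3"
  shows "d dvd fseq n"
proof -
  obtain j where j: "n = Suc j" "l \<le> j" using assms(1) by (cases n) auto
  have "d dvd (fact (fseq j + 3) :: nat)"
    using assms(2,3) fseq_mono[OF j(2)] by (intro dvd_fact) auto
  then show ?thesis using j(1) by simp
qed

text \<open>The divisibility-closed set generated by the differences on which
  \<open>u \<ominus> v\<close> lives. The generators are negated, which keeps their multiples and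
  makes them positive for size estimates.\<close>

definition diff_multiples :: "int set" where
  "diff_multiples = {z. \<exists>k l. k < l \<and> int (fseq l) + 1 - int (fseq k) dvd z}"

text \<open>Let \<open>d\<close> be the divisor given by \<open>k < l\<close>. Modulo
  \<open>d\<close>, terms of index above \<open>l\<close> vanish and \<open>fseq l\<close> is
  \<open>fseq k - 1\<close>; terms of index below \<open>l\<close> are smaller than
  \<open>d - 3\<close>. Wherever \<open>m < n\<close> lie relative to \<open>l\<close>, what remains
  is a nonzero number of absolute value below \<open>d\<close>.\<close>

lemma fseq_diff_notin:
  assumes "m < n"
  shows "int (fseq m) + 1 - int (fseq n) \<notin> diff_multiples"
proof
  assume "int (fseq m) + 1 - int (fseq n) \<in> diff_multiples"
  then obtain k l where kl: "k < l"
      and dvd0: "int (fseq l) + 1 - int (fseq k) dvd int (fseq m) + 1 - int (fseq n)"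
    unfolding diff_multiples_def by blast
  define d where "d = int (fseq l) + 1 - int (fseq k)"
  have dvd: "d dvd int (fseq m) + 1 - int (fseq n)" using dvd0 by (simp add: d_def)
  \<comment> \<open>Half the sum of the two gap inequalities is
    \<open>fseq l > fseq j + fseq k + 3\<close>.\<close>
  have small: "int (fseq j) + 3 < d" if "j < l" for j
    using fseq_gap[OF that] fseq_gap[OF kl] unfolding d_def by linarith
  have no: "False" if "d dvd z" "z \<noteq> 0" "\<bar>z\<bar> < d" for z
    using dvd_imp_le_int[OF that(2,1)] that(3) by linarith
  have d4: "d > 4" using small[OF kl] fseq_pos[of k] by simp
  have mult: "d dvd int (fseq j)" if "l < j" for j
  proof -
    \<comment> \<open>Since \<open>fseq k \<ge> 1\<close>, the divisor \<open>d\<close> is at most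
      \<open>fseq l\<close>.\<close>
    have "nat d dvd fseq j"
      using d4 fseq_pos[of k] by (intro dvd_fseq[OF that]) (auto simp: d_def)
    then show ?thesis using d4 by (metis int_dvd_int_iff int_nat_eq less_imp_le order_trans zero_le_numeral)
  qed
  note gap = fseq_gap[OF assms]
  consider "n < l" | "n = l" | "n > l" by linarith
  then show False
  proof cases
    case 1
    then show False using no[OF dvd] small[of n] gap by simp
  next
    case 2
    have eq: "(int (fseq m) + 1 - int (fseq n)) + d = int (fseq m) + 2 - int (fseq k)"
      using 2 by (simp add: d_def)
    have "d dvd (int (fseq m) + 1 - int (fseq n)) + d" using dvd by simp
    then have dvd': "d dvd int (fseq m) + 2 - int (fseq k)" unfolding eq .
    \<comment> \<open>Equality would force \<open>m < k\<close>, but a later term exceeds an earlier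
      one by more than 3.\<close>
    have "int (fseq m) + 2 - int (fseq k) \<noteq> 0"
      using fseq_gap[of m k] fseq_mono[of k m] by linarith
    then show False
      using no[OF dvd'] small[of m] small[of k] kl assms 2 fseq_pos[of k] fseq_pos[of m] by linarith
  next
    case 3
    then have dvd': "d dvd int (fseq m) + 1"
      using dvd mult[of n] by (metis diff_add_cancel dvd_add)
    consider "m < l" | "m = l" | "m > l" by linarith
    then show False
    proof cases
      case 1
      then show False using no[OF dvd'] small[of m] by simp
    next
      case 2
      have "int (fseq k) = (int (fseq m) + 1) - d" using 2 by (simp add: d_def)
      then have "d dvd int (fseq k)" using dvd' by simp
      then show False using no[of "int (fseq k)"] small[OF kl] fseq_pos[of k] by linarith
    next
      case 3
      then have "d dvd 1" using dvd' mult[of m] dvd_add_right_iff by blast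
      then show False using d4 by simp
    qed
  qed
qed

section \<open>Construction of the ultrafilters and failure of symmetry\<close>

theorem corollary2p6:
  fixes emb :: "int \<Rightarrow> 'm"
    and I :: "int list set \<Rightarrow> 'm list set"
  assumes "elementary_extension emb I"
    and "saturated (cardSuc |UNIV :: nat set set| ) I"
  shows "\<exists>w \<in> betaZ - {principal {0}}. \<not> symp_on betaZ (equiv_mod I w)"
proof -
  note ext = assms(1)
  \<comment> \<open>Tails of the sequence: any finitely many share a point, so some
    \<open>\<alpha>\<close> lies in the extension of all of them. This makes its type
    nonprincipal.\<close>
  let ?T = "\<lambda>N. {[int (fseq n)] |n. N \<le> n}"
  have "\<exists>as. length as = 1 \<and> (\<forall>A\<in>range ?T. as \<in> I A)"
  proof (rule saturated_realizes[OF assms])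
    fix F assume "finite F" "F \<subseteq> range ?T"
    then obtain F0 where F0: "finite F0" "F = ?T ` F0"
      using finite_subset_image by (metis (no_types, lifting))
    then obtain N where "\<forall>n\<in>F0. n \<le> N"
      using finite_nat_set_iff_bounded_le by blast
    then show "\<exists>xs. length xs = 1 \<and> xs \<in> \<Inter>F"
      by (intro exI[of _ "[int (fseq N)]"]) (auto simp: F0(2))
  qed auto
  then obtain \<alpha> where \<alpha>: "\<And>N. [\<alpha>] \<in> I (?T N)"
    by (auto simp: length_Suc_conv)
  define u where "u = type_of I \<alpha>"
  define v where "v = filtermap (\<lambda>x. x + 1) u"
  have u: "ultrafilter u" unfolding u_def by (rule ultrafilter_type_of[OF ext])
  then have v: "ultrafilter v" unfolding v_def by (rule ultrafilter_filtermap)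
  have ev_u: "\<forall>\<^sub>F x in u. \<exists>n\<ge>N. x = int (fseq n)" for N
  proof -
    have "{[x] |x. \<exists>n\<ge>N. x = int (fseq n)} = ?T N" by auto
    then show ?thesis using \<alpha>[of N] by (simp add: u_def eventually_type_of[OF ext])
  qed
  have ev_v: "\<forall>\<^sub>F y in v. \<exists>n\<ge>N. y = int (fseq n) + 1" for N
    using ev_u[of N] by (simp add: v_def eventually_filtermap)
  have uv: "\<forall>\<^sub>F z in u \<otimes>\<^sub>u v. \<exists>k l. k < l \<and> z = (int (fseq k), int (fseq l) + 1)"
    unfolding eventually_tensor using ev_u[of 0]
  proof eventually_elim
    case (elim x)
    then obtain k where k: "x = int (fseq k)" by blast
    \<comment> \<open>Once \<open>k\<close> is fixed, the tail beyond \<open>k\<close> is still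
      large for \<open>v\<close>; hence the strict order of the indices.\<close>
    show ?case using ev_v[of "Suc k"] by eventually_elim (auto simp: k Suc_le_eq)
  qed
  have vu: "\<forall>\<^sub>F z in v \<otimes>\<^sub>u u. \<exists>m n. m < n \<and> z = (int (fseq m) + 1, int (fseq n))"
    unfolding eventually_tensor using ev_v[of 0]
  proof eventually_elim
    case (elim x)
    then obtain k where k: "x = int (fseq k) + 1" by blast
    show ?case using ev_u[of "Suc k"] by eventually_elim (auto simp: k Suc_le_eq)
  qed
  obtain a b where ab: "realizes2 I (a, b) (u \<otimes>\<^sub>u v)"
    using realizes2_exists[OF assms ultrafilter_tensor[OF u v]] by auto
  obtain c where c: "[a, b, c] \<in> I {[x, y, x - y] |x y. True}"
    using star_diff_total[OF ext] by blast
  define w where "w = type_of I c"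
  \<comment> \<open>This says that every set in \<open>u \<ominus> v\<close> belongs to
    \<open>w\<close>.\<close>
  have w_diff: "\<forall>\<^sub>F x in w. x \<in> A" if "\<forall>\<^sub>F z in u \<otimes>\<^sub>u v. fst z - snd z \<in> A" for A
  proof -
    have "\<forall>\<^sub>F z in u \<otimes>\<^sub>u v. z \<in> {(x, y). x - y \<in> A}"
      using that by (simp add: case_prod_beta)
    then have "[a, b] \<in> I {[x, y] |x y. (x, y) \<in> {(x, y). x - y \<in> A}}"
      using ab unfolding realizes2_def fst_conv snd_conv by blast
    from star_diff[OF ext c this] show ?thesis
      by (simp add: w_def eventually_type_of[OF ext])
  qed
  have "\<forall>\<^sub>F x in w. x \<in> - {0}"
  proof (rule w_diff, rule eventually_mono[OF uv], clarsimp)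
    fix k l :: nat assume "k < l" "int (fseq k) = int (fseq l) + 1"
    then show False using fseq_gap[of k l] by simp
  qed
  then have "w \<noteq> principal {0}"
    by (auto simp: eventually_principal)
  moreover have "w \<in> betaZ"
    by (simp add: betaZ_def w_def ultrafilter_type_of[OF ext])
  moreover have "equiv_mod I w u v"
    unfolding equiv_mod_def dvd_diff_def
    using realizes_type_of[OF ext, of c] ab c star_dvd_refl[OF ext, of c] w_def by blast
  moreover have "\<not> equiv_mod I w v u"
  proof
    assume "equiv_mod I w v u"
    then obtain d b' a' c' where d: "realizes I d w"
        and ba: "realizes2 I (b', a') (v \<otimes>\<^sub>u u)"
        and c': "[b', a', c'] \<in> I {[x, y, x - y] |x y. True}"
        and dc: "[d, c'] \<in> I {[x, y] |x y. x dvd y}"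
      unfolding equiv_mod_def dvd_diff_def by blast
    \<comment> \<open>The separating set is in \<open>w\<close>, so its extension contains
      \<open>d\<close> and hence the multiple \<open>c'\<close>; but the differences under
      \<open>v \<otimes>\<^sub>u u\<close> avoid it.\<close>
    have "\<forall>\<^sub>F x in w. x \<in> diff_multiples"
    proof (rule w_diff, rule eventually_mono[OF uv], clarsimp)
      fix k l :: nat assume "k < l"
      moreover have "int (fseq l) + 1 - int (fseq k) dvd int (fseq k) - (int (fseq l) + 1)"
        by (metis dvd_minus_iff dvd_refl minus_diff_eq)
      ultimately show "int (fseq k) - (int (fseq l) + 1) \<in> diff_multiples"
        unfolding diff_multiples_def by blast
    qed
    then have "[d] \<in> I {[x] |x. x \<in> diff_multiples}"
      using d by (simp add: realizes_def)
    then have in_B: "[c'] \<in> I {[x] |x. x \<in> diff_multiples}"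
      by (rule star_dvd_closed[OF ext _ dc]) (auto simp: diff_multiples_def intro: dvd_trans)
    have "\<forall>\<^sub>F z in v \<otimes>\<^sub>u u. z \<in> {(x, y). x - y \<in> - diff_multiples}"
      by (rule eventually_mono[OF vu]) (auto simp: fseq_diff_notin)
    then have "[b', a'] \<in> I {[x, y] |x y. (x, y) \<in> {(x, y). x - y \<in> - diff_multiples}}"
      using ba unfolding realizes2_def fst_conv snd_conv by blast
    from star_diff[OF ext c' this] in_B show False
      unfolding star1_Compl[OF ext] by contradiction
  qed
  moreover have "u \<in> betaZ" "v \<in> betaZ"
    using u v by (simp_all add: betaZ_def)
  ultimately show ?thesis
    unfolding symp_on_def by blast
qed

end
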